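(* Let $n\ge 3$ and let $C_n$ be the cycle of order $n$. (i) If $S\in\mathcal{S}_{1,2,4,4}$, then $C_n$ is $\chi_S$-critical if and only if $n\in\{3,5,6,7,9\}$. (ii) If $S\in\mathcal{S}_{1,2,\overline{4},5}$, then $C_n$ is $\chi_S$-critical if and only if $n\in\{3,5,6,7,9,10,11,17\}$. (iii) If $S\in\mathcal{S}_{1,2,\overline{4},6}$, then $C_n$ is $\chi_S$-critical if and only if $n\in\{3,5,6,7,9,10,11,12,13,17,18,19,20,25,26,27,33,34,41\}$.
   Context: A packing sequence is a non-decreasing infinite sequence $S=(s_1,s_2,\ldots)$ of positive integers. For a graph $G$, a map $\phi\colon V(G)\to\{1,\ldots,k\}$ is an $S$-packing $k$-coloring if any two distinct vertices $u,v$ with $\phi(u)=\phi(v)=i$ satisfy $d_G(u,v) > s_i$; $\chi_S(G)$ is the least such $k$. A graph $G$ is $\chi_S$-critical if $\chi_S(H)<\chi_S(G)$ for every proper subgraph $H$ of $G$. Notation: $\mathcal{S}_{a_1,\ldots,a_m}$ is the set of packing sequences with $s_j=a_j$ for $j\le m$ (later entries arbitrary subject to being a packing sequence); $\mathcal{S}_{a_1,\ldots,a_{i-1},\overline{a_i},a_{i+1},\ldots,a_m}$ is the set of packing sequences with $s_j=a_j$ for $j\le m$, $j\ne i$, and $a_i\le s_i\le a_{i+1}$. Thus $\mathcal{S}_{1,2,4,4}$: $s_1=1,s_2=2,s_3=s_4=4$; $\mathcal{S}_{1,2,\overline{4},5}$: $s_1=1,s_2=2,4\le s_3\le5,s_4=5$;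 $\mathcal{S}_{1,2,\overline{4},6}$: $s_1=1,s_2=2,4\le s_3\le 6,s_4=6$. *)

theory Defs
  imports Main "HOL-Library.Extended_Nat"
begin

type_synonym 'a graph = "'a set \<times> 'a set set"

abbreviation verts :: "'a graph \<Rightarrow> 'a set" where
  "verts G \<equiv> fst G"

abbreviation edges :: "'a graph \<Rightarrow> 'a set set" where
  "edges G \<equiv> snd G"

definition simple_graph :: "'a graph \<Rightarrow> bool" where
  "simple_graph G \<longleftrightarrow> finite (verts G) \<and> (\<forall>e\<in>edges G. e \<subseteq> verts G \<and> card e = 2)"

definition proper_subgraph :: "'a graph \<Rightarrow> 'a graph \<Rightarrow> bool" where
  "proper_subgraph H G \<longleftrightarrow>
     simple_graph H \<and> verts H \<subseteq> verts G \<and> edges H \<subseteq> edges G \<and> H \<noteq> G"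

definition walk_betw :: "'a graph \<Rightarrow> 'a \<Rightarrow> 'a list \<Rightarrow> 'a \<Rightarrow> bool" where
  "walk_betw G u p v \<longleftrightarrow>
     p \<noteq> [] \<and> hd p = u \<and> last p = v \<and> set p \<subseteq> verts G \<and>
     successively (\<lambda>x y. {x, y} \<in> edges G) p"

text \<open>A walk is the list of its vertices, so its length is one less than that of the list.
  The infimum of the empty set in \<^typ>\<open>enat\<close> is \<open>\<infinity>\<close>, the distance between vertices in
  different components.\<close>

definition graph_dist :: "'a graph \<Rightarrow> 'a \<Rightarrow> 'a \<Rightarrow> enat" where
  "graph_dist G u v = (INF p\<in>{p. walk_betw G u p v}. enat (length p - 1))"

definition cycle_graph :: "nat \<Rightarrow> nat graph" where
  "cycle_graph n = ({0..<n}, {{i, (i + 1) mod n} | i. i < n})"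

lemma simple_graph_cycle_graph:
  assumes "n \<ge> 3"
  shows "simple_graph (cycle_graph n)"
proof -
  have "i \<noteq> (i + 1) mod n" if "i < n" for i
    using that assms by (cases "i + 1 = n") auto
  then show ?thesis
    using assms by (auto simp: simple_graph_def cycle_graph_def card_insert_if)
qed

text \<open>Sequences are indexed from 1; the value at 0 plays no role.\<close>

definition packing_sequence :: "(nat \<Rightarrow> nat) \<Rightarrow> bool" where
  "packing_sequence s \<longleftrightarrow> (\<forall>i\<ge>1. s i > 0) \<and> (\<forall>i\<ge>1. \<forall>j\<ge>i. s i \<le> s j)"

text \<open>\<open>packing_seqs [a\<^sub>1, \<dots>, a\<^sub>m]\<close> is $\mathcal{S}_{a_1,\ldots,a_m}$, and
  \<open>packing_seqs_bar i [a\<^sub>1, \<dots>, a\<^sub>m]\<close> (for \<open>1 \<le> i < m\<close>) is the same with a bar over \<open>a\<^sub>i\<close>.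
  Lists are indexed from 0, so \<open>a\<^sub>j\<close> is \<open>as ! (j - 1)\<close>.\<close>

definition packing_seqs :: "nat list \<Rightarrow> (nat \<Rightarrow> nat) set" where
  "packing_seqs as = {s. packing_sequence s \<and> (\<forall>j\<in>{1..length as}. s j = as ! (j - 1))}"

definition packing_seqs_bar :: "nat \<Rightarrow> nat list \<Rightarrow> (nat \<Rightarrow> nat) set" where
  "packing_seqs_bar i as = {s. packing_sequence s \<and>
     (\<forall>j\<in>{1..length as} - {i}. s j = as ! (j - 1)) \<and> as ! (i - 1) \<le> s i \<and> s i \<le> as ! i}"

definition packing_coloring :: "(nat \<Rightarrow> nat) \<Rightarrow> 'a graph \<Rightarrow> nat \<Rightarrow> ('a \<Rightarrow> nat) \<Rightarrow> bool" where
  "packing_coloring s G k \<phi> \<longleftrightarrow>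
     \<phi> ` verts G \<subseteq> {1..k} \<and>
     (\<forall>u\<in>verts G. \<forall>v\<in>verts G. u \<noteq> v \<and> \<phi> u = \<phi> v \<longrightarrow> graph_dist G u v > enat (s (\<phi> u)))"

definition packing_chromatic :: "(nat \<Rightarrow> nat) \<Rightarrow> 'a graph \<Rightarrow> nat" where
  "packing_chromatic s G = (LEAST k. \<exists>\<phi>. packing_coloring s G k \<phi>)"

text \<open>The minimum is attained on finite graphs, since coloring all vertices differently is allowed.\<close>

lemma ex_packing_coloring:
  assumes "finite (verts G)"
  shows "\<exists>k \<phi>. packing_coloring s G k \<phi>"
proof -
  obtain f :: "'a \<Rightarrow> nat" and n where f: "f ` verts G = {i. i < n}" "inj_on f (verts G)"
    using finite_imp_inj_to_nat_seg[OF assms] by blast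
  have "packing_coloring s G n (\<lambda>v. Suc (f v))"
    using f unfolding packing_coloring_def
    by (auto dest: inj_onD simp flip: less_eq_Suc_le)
  then show ?thesis by blast
qed

definition packing_critical :: "(nat \<Rightarrow> nat) \<Rightarrow> 'a graph \<Rightarrow> bool" where
  "packing_critical s G \<longleftrightarrow>
     (\<forall>H. proper_subgraph H G \<longrightarrow> packing_chromatic s H < packing_chromatic s G)"

end

theory Submission
  imports Defs
begin

text \<open>Deleting an edge shows that \<open>C\<^sub>n\<close> is critical iff for some \<open>k\<close> the path \<open>P\<^sub>n\<close> is
  \<open>k\<close>-colorable and \<open>C\<^sub>n\<close> is not. Four consecutive vertices cannot be colored by 1 and 2, and
  therefore (as \<open>s\<^sub>3 \<ge> 4\<close>) eight consecutive vertices cannot be colored by 1, 2 and 3. So for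
  \<open>n \<ge> 8\<close> the path needs exactly four colors, and in a 4-coloring of \<open>C\<^sub>n\<close> with \<open>q\<close> vertices of
  color 4 every window of length 8 contains at least one and every window of length \<open>s\<^sub>4 + 1\<close> at
  most one of them, which gives \<open>(s\<^sub>4 + 1) q \<le> n \<le> 8 q\<close>. Conversely, if this holds for some \<open>q\<close>,
  then \<open>C\<^sub>n\<close> is colored by concatenating \<open>q\<close> of the blocks 12314, 123124, 1213214, 12131214.\<close>

section \<open>Distances in paths and cycles\<close>

text \<open>A weak lower bound on an infimum can be tested walk by walk, a strict one in general
  cannot; hence the detour through \<open>Suc m\<close>. Vertices joined by no walk are covered,
  their distance being \<infinity>.\<close>

lemma less_graph_dist_iff:
  "enat m < graph_dist G u v \<longleftrightarrow> (\<forall>p. walk_betw G u p v \<longrightarrow> m < length p - 1)"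
proof -
  have "enat m < graph_dist G u v \<longleftrightarrow> enat (Suc m) \<le> graph_dist G u v"
    by (simp add: Suc_ile_eq)
  also have "\<dots> \<longleftrightarrow> (\<forall>p. walk_betw G u p v \<longrightarrow> m < length p - 1)"
    unfolding graph_dist_def by (auto simp: le_INF_iff)
  finally show ?thesis .
qed

text \<open>The modulus 0 serves paths, where divisibility by 0 is equality; the modulus \<open>n\<close> serves
  the cycle.\<close>

lemma walk_displacement:
  fixes pos :: "'a \<Rightarrow> int" and m :: int
  assumes edge: "\<And>x y. {x, y} \<in> edges G \<Longrightarrow> \<exists>e. \<bar>e\<bar> \<le> 1 \<and> m dvd pos y - pos x - e"
    and "walk_betw G u p v"
  shows "\<exists>e. \<bar>e\<bar> \<le> int (length p - 1) \<and> m dvd pos v - pos u - e"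
  using assms(2)
proof (induction p arbitrary: u)
  case Nil
  then show ?case by (simp add: walk_betw_def)
next
  case (Cons x p)
  show ?case
  proof (cases p)
    case Nil
    then show ?thesis using Cons.prems by (auto simp: walk_betw_def)
  next
    case (Cons y r)
    then have "walk_betw G y p v" and xy: "{u, y} \<in> edges G"
      using Cons.prems by (auto simp: walk_betw_def)
    then obtain e where e: "\<bar>e\<bar> \<le> int (length p - 1)" "m dvd pos v - pos y - e"
      using Cons.IH by blast
    obtain e' where e': "\<bar>e'\<bar> \<le> 1" "m dvd pos y - pos u - e'"
      using edge[OF xy] by blast
    have "m dvd (pos v - pos y - e) + (pos y - pos u - e')"
      using e e' by (intro dvd_add)
    then have "m dvd pos v - pos u - (e + e')" by (simp add: algebra_simps)
    moreover have "\<bar>e + e'\<bar> \<le> int (length (x # p) - 1)"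
      using e e' Cons by auto
    ultimately show ?thesis by blast
  qed
qed

definition path_graph :: "nat \<Rightarrow> nat graph" where
  "path_graph n = ({0..<n}, {{i, i + 1} | i. i + 1 < n})"

lemma path_graph_dist:
  assumes "i < j" "j < n" "enat m < graph_dist (path_graph n) i j"
  shows "m < j - i"
proof -
  have "walk_betw (path_graph n) i [i..<Suc j] j"
    using assms(1,2)
    by (auto simp: walk_betw_def path_graph_def successively_conv_nth simp del: upt_Suc)
  then show ?thesis
    using assms unfolding less_graph_dist_iff by fastforce
qed

text \<open>Going \<open>d\<close> steps forward is a walk, even if it winds around the cycle, so
  the distance is at most \<open>d\<close>.\<close>

lemma cycle_graph_dist:
  assumes "n \<ge> 3" "0 < d" "enat m < graph_dist (cycle_graph n) (i mod n) ((i + d) mod n)"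
  shows "m < d"
proof -
  have "walk_betw (cycle_graph n) (i mod n) (map (\<lambda>j. (i + j) mod n) [0..<Suc d]) ((i + d) mod n)"
    using assms(1)
    by (auto simp: walk_betw_def cycle_graph_def successively_conv_nth hd_map last_map mod_Suc_eq
        simp del: upt_Suc intro!: exI[of _ "(i + _) mod n"])
  then show ?thesis
    using assms unfolding less_graph_dist_iff by fastforce
qed

section \<open>Colorings of paths and cycles\<close>

text \<open>Gaps are measured on the number line inside a half-open window, so that one notion
  serves paths and unrolled cycles.\<close>

definition spaced :: "(nat \<Rightarrow> nat) \<Rightarrow> (nat \<Rightarrow> nat) \<Rightarrow> nat \<Rightarrow> nat \<Rightarrow> bool" where
  "spaced s f a b \<longleftrightarrow> (\<forall>i j. a \<le> i \<and> i < j \<and> j < b \<and> f i = f j \<longrightarrow> s (f i) < j - i)"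

lemma spacedD: "spaced s f a b \<Longrightarrow> a \<le> i \<Longrightarrow> i < j \<Longrightarrow> j < b \<Longrightarrow> f i = f j \<Longrightarrow> s (f i) < j - i"
  unfolding spaced_def by blast

lemma spaced_subset: "spaced s f a b \<Longrightarrow> a \<le> a' \<Longrightarrow> b' \<le> b \<Longrightarrow> spaced s f a' b'"
  unfolding spaced_def by (meson le_trans less_le_trans)

definition path_col :: "(nat \<Rightarrow> nat) \<Rightarrow> nat \<Rightarrow> nat \<Rightarrow> (nat \<Rightarrow> nat) \<Rightarrow> bool" where
  "path_col s n k f \<longleftrightarrow> f ` {0..<n} \<subseteq> {1..k} \<and> spaced s f 0 n"

text \<open>A coloring of the cycle is encoded as an \<open>n\<close>-periodic function.\<close>

definition cycle_col :: "(nat \<Rightarrow> nat) \<Rightarrow> nat \<Rightarrow> nat \<Rightarrow> (nat \<Rightarrow> nat) \<Rightarrow> bool" where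
  "cycle_col s n k f \<longleftrightarrow>
     range f \<subseteq> {1..k} \<and> (\<forall>i. f (i + n) = f i) \<and> (\<forall>a. spaced s f a (a + n))"

lemma cycle_colD:
  assumes "cycle_col s n k f"
  shows "f i \<in> {1..k}" "f (i + n) = f i" "b \<le> a + n \<Longrightarrow> spaced s f a b"
proof -
  show "f i \<in> {1..k}" "f (i + n) = f i" using assms unfolding cycle_col_def by blast+
  have "spaced s f a (a + n)" using assms unfolding cycle_col_def by blast
  then show "spaced s f a b" if "b \<le> a + n" using that by (rule spaced_subset[OF _ order_refl])
qed

lemma cycle_col_if_packing_coloring:
  assumes n: "n \<ge> 3" and \<phi>: "packing_coloring s (cycle_graph n) k \<phi>"
  shows "cycle_col s n k (\<lambda>i. \<phi> (i mod n))"
proof -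
  have "s (\<phi> (i mod n)) < j - i"
    if "a \<le> i" "i < j" "j < a + n" "\<phi> (i mod n) = \<phi> (j mod n)" for a i j
  proof -
    have "i mod n \<noteq> j mod n"
    proof
      assume "i mod n = j mod n"
      then have "n dvd j - i" using that by (metis mod_eq_dvd_iff_nat less_imp_le)
      then show False using that by (auto dest: dvd_imp_le)
    qed
    then have "enat (s (\<phi> (i mod n))) < graph_dist (cycle_graph n) (i mod n) (j mod n)"
      using \<phi> that n by (simp add: packing_coloring_def cycle_graph_def)
    then show ?thesis
      using cycle_graph_dist[OF n, of "j - i" _ i] that by simp
  qed
  then show ?thesis
    using \<phi> n
    by (auto simp: cycle_col_def packing_coloring_def spaced_def cycle_graph_def image_subset_iff)
qed

lemma cycle_col_mod:
  assumes "cycle_col s n k f"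
  shows "f (i mod n) = f i"
proof -
  have "f (j + m * n) = f j" for j m
    by (induction m) (use cycle_colD(2)[OF assms, of "j + _ * n"] in \<open>simp_all add: ac_simps\<close>)
  from this[of "i mod n" "i div n"] show ?thesis by simp
qed

text \<open>A walk from \<open>u\<close> to \<open>v\<close> has a signed displacement
  \<open>e\<close>, congruent to \<open>v - u\<close> modulo \<open>n\<close> and no longer than the
  walk. If \<open>e \<ge> 0\<close>, then \<open>u + e mod n\<close> represents \<open>v\<close> in
  the window of length \<open>n\<close> starting at \<open>u\<close>, so spacing bounds
  \<open>e mod n\<close>, hence \<open>e\<close>, from below. For \<open>e < 0\<close> swap
  \<open>u\<close> and \<open>v\<close>.\<close>

lemma packing_coloring_if_cycle_col:
  assumes n: "n \<ge> 3" and f: "cycle_col s n k f"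
  shows "packing_coloring s (cycle_graph n) k f"
proof -
  have edge: "\<exists>e. \<bar>e\<bar> \<le> 1 \<and> int n dvd int y - int x - e"
    if xy: "{x, y} \<in> edges (cycle_graph n)" for x y
  proof -
    have dvd: "int n dvd int ((i + 1) mod n) - int i - 1" for i
    proof -
      have "int n dvd int ((i + 1) mod n) - int (i + 1)"
        unfolding zmod_int by (metis dvd_minus_mod dvd_minus_iff minus_diff_eq)
      then show ?thesis by (simp add: algebra_simps)
    qed
    obtain i where "x = i \<and> y = (i + 1) mod n \<or> y = i \<and> x = (i + 1) mod n"
      using xy by (auto simp: cycle_graph_def doubleton_eq_iff)
    then show ?thesis
    proof
      assume "x = i \<and> y = (i + 1) mod n"
      then show ?thesis using dvd[of i] by (intro exI[of _ 1]) simp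
    next
      assume "y = i \<and> x = (i + 1) mod n"
      moreover have "int n dvd - (int ((i + 1) mod n) - int i - 1)"
        using dvd[of i] by (simp only: dvd_minus_iff)
      then have "int n dvd int i - int ((i + 1) mod n) - (- 1)" by (simp add: algebra_simps)
      ultimately show ?thesis by (intro exI[of _ "- 1"]) simp
    qed
  qed
  have lt_nat: "s (f u) < e"
    if "f u = f v" "u \<noteq> v" "u < n" "v < n" and e: "int n dvd int v - int u - int e" for u v e
  proof -
    have "int v mod int n = int (u + e) mod int n"
      using e by (simp add: mod_eq_dvd_iff algebra_simps)
    then have v: "v = (u + e mod n) mod n"
      using that by (metis mod_add_right_eq mod_less of_nat_eq_iff zmod_int)
    then have "0 < e mod n" using that by (cases "e mod n") auto
    moreover have "f (u + e mod n) = f u"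
      using cycle_col_mod[OF f, of "u + e mod n"] v that by simp
    ultimately have "s (f u) < u + e mod n - u"
      using n cycle_colD(3)[OF f, of "u + n" u] by (intro spacedD) auto
    also have "\<dots> \<le> e" by simp
    finally show ?thesis .
  qed
  have lt: "s (f u) < nat \<bar>e\<bar>"
    if "f u = f v" "u \<noteq> v" "u < n" "v < n" and e: "int n dvd int v - int u - e" for u v e
  proof (cases "e \<ge> 0")
    case True
    then show ?thesis using lt_nat[of u v "nat e"] that by simp
  next
    case False
    have "int n dvd - (int v - int u - e)" using e by (simp only: dvd_minus_iff)
    then have "int n dvd int u - int v - int (nat (- e))" using False by (simp add: algebra_simps)
    then show ?thesis using lt_nat[of v u "nat (- e)"] that False by simp
  qed
  have "s (f u) < length p - 1"
    if "u < n" "v < n" "u \<noteq> v" "f u = f v" and p: "walk_betw (cycle_graph n) u p v" for u v p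
  proof -
    obtain e where e: "\<bar>e\<bar> \<le> int (length p - 1)" "int n dvd int v - int u - e"
      using walk_displacement[where pos = int and m = "int n", OF edge p] by blast
    then have "s (f u) < nat \<bar>e\<bar>" using that by (intro lt)
    with e show ?thesis by linarith
  qed
  then show ?thesis
    using cycle_colD(1)[OF f]
    by (auto simp: packing_coloring_def less_graph_dist_iff cycle_graph_def)
qed

lemma path_col_if_packing_coloring:
  assumes "packing_coloring s (path_graph n) k \<phi>"
  shows "path_col s n k \<phi>"
proof -
  have "s (\<phi> i) < j - i" if "i < j" "j < n" "\<phi> i = \<phi> j" for i j
    using assms that
    by (intro path_graph_dist[of i j n]) (auto simp: packing_coloring_def path_graph_def)
  then show ?thesis
    using assms by (auto simp: path_col_def packing_coloring_def spaced_def path_graph_def)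
qed

section \<open>Criticality in terms of colorings of the path and the cycle\<close>

text \<open>A subgraph with all edges of the cycle contains their endpoints, hence all vertices, and
  is the whole cycle.\<close>

lemma proper_subgraph_missing_edge:
  assumes n: "n \<ge> 3" and H: "proper_subgraph H (cycle_graph n)"
  shows "\<exists>a<n. {a, (a + 1) mod n} \<notin> edges H"
proof (rule ccontr)
  assume "\<not> ?thesis"
  then have all: "\<And>a. a < n \<Longrightarrow> {a, (a + 1) mod n} \<in> edges H" by blast
  then have "a \<in> verts H" if "a < n" for a
    using that H unfolding proper_subgraph_def simple_graph_def by blast
  then have "verts (cycle_graph n) \<subseteq> verts H" by (auto simp: cycle_graph_def)
  moreover have "edges (cycle_graph n) \<subseteq> edges H" using all by (auto simp: cycle_graph_def)
  ultimately show False using H by (auto simp: proper_subgraph_def prod_eq_iff)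
qed

text \<open>Cut the cycle at a missing edge and color along the resulting path. Edges of
  \<open>H\<close> change the position on it by at most 1, so no walk is shorter than the difference
  of positions.\<close>

lemma proper_subgraph_coloring:
  assumes n: "n \<ge> 3" and H: "proper_subgraph H (cycle_graph n)" and f: "path_col s n k f"
  shows "\<exists>\<phi>. packing_coloring s H k \<phi>"
proof -
  obtain a where a: "a < n" "{a, (a + 1) mod n} \<notin> edges H"
    using proper_subgraph_missing_edge[OF n H] by blast
  \<comment> \<open>Positions start just after the missing edge: \<open>(a + 1) mod n\<close> gets 0
    and \<open>a\<close> gets \<open>n - 1\<close>.\<close>
  define pos where "pos v = (if v \<le> a then v + n - (a + 1) else v - (a + 1))" for v
  have edge: "\<exists>e. \<bar>e\<bar> \<le> 1 \<and> 0 dvd int (pos y) - int (pos x) - e"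
    if xy: "{x, y} \<in> edges H" for x y
  proof -
    have near: "\<bar>int (pos ((i + 1) mod n)) - int (pos i)\<bar> \<le> 1" if "i < n" "i \<noteq> a" for i
      using that a by (cases "i + 1 = n") (auto simp: pos_def of_nat_diff)
    have "{x, y} \<in> edges (cycle_graph n)" using xy H by (auto simp: proper_subgraph_def)
    then obtain i where i: "i < n" "{x, y} = {i, (i + 1) mod n}"
      by (auto simp: cycle_graph_def)
    then have "i \<noteq> a" using a xy by metis
    then have "\<bar>int (pos y) - int (pos x)\<bar> \<le> 1"
      using near[of i] i by (auto simp: doubleton_eq_iff)
    then show ?thesis by (intro exI[of _ "int (pos y) - int (pos x)"]) simp
  qed
  have lt: "s (f (pos u)) < length p - 1"
    if "u < n" "v < n" "u \<noteq> v" "f (pos u) = f (pos v)" and p: "walk_betw H u p v" for u v p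
  proof -
    have "\<bar>int (pos v) - int (pos u)\<bar> \<le> int (length p - 1)"
      using walk_displacement[where pos = "\<lambda>v. int (pos v)" and m = 0, OF edge p] by auto
    moreover have "pos u \<noteq> pos v" "pos u < n" "pos v < n" using that a by (auto simp: pos_def)
    then have "s (f (pos u)) < nat \<bar>int (pos v) - int (pos u)\<bar>"
      using f that(4) spacedD[of s f 0 n "pos u" "pos v"] spacedD[of s f 0 n "pos v" "pos u"]
      unfolding path_col_def by (cases "pos u < pos v") auto
    ultimately show ?thesis by linarith
  qed
  have V: "v < n" if "v \<in> verts H" for v
    using that H by (auto simp: proper_subgraph_def cycle_graph_def)
  then have "f (pos v) \<in> {1..k}" if "v \<in> verts H" for v
  proof -
    have "pos v < n" using V[OF that] a by (auto simp: pos_def)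
    then show ?thesis using f by (auto simp: path_col_def image_subset_iff)
  qed
  then have "packing_coloring s H k (\<lambda>v. f (pos v))"
    using lt V unfolding packing_coloring_def less_graph_dist_iff by blast
  then show ?thesis by blast
qed

lemma proper_subgraph_path_graph:
  assumes "n \<ge> 3"
  shows "proper_subgraph (path_graph n) (cycle_graph n)"
proof -
  have "\<exists>j. {i, Suc i} = {j, Suc j mod n} \<and> j < n" if "Suc i < n" for i
    using that by (intro exI[of _ i]) simp
  then have "edges (path_graph n) \<subseteq> edges (cycle_graph n)"
    by (auto simp: path_graph_def cycle_graph_def)
  moreover have "{n - 1, 0} \<in> edges (cycle_graph n)"
    using assms by (auto simp: cycle_graph_def intro!: exI[of _ "n - 1"])
  moreover have "{n - 1, 0} \<notin> edges (path_graph n)"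
    using assms by (auto simp: path_graph_def doubleton_eq_iff)
  moreover have "simple_graph (path_graph n)"
    by (auto simp: simple_graph_def path_graph_def)
  moreover have "verts (path_graph n) \<subseteq> verts (cycle_graph n)"
    by (simp add: path_graph_def cycle_graph_def)
  ultimately show ?thesis unfolding proper_subgraph_def by metis
qed

lemma packing_chromatic_le_iff:
  assumes "finite (verts G)"
  shows "packing_chromatic s G \<le> k \<longleftrightarrow> (\<exists>\<phi>. packing_coloring s G k \<phi>)"
proof
  assume le: "packing_chromatic s G \<le> k"
  obtain \<phi> where "packing_coloring s G (packing_chromatic s G) \<phi>"
    unfolding packing_chromatic_def using LeastI_ex[OF ex_packing_coloring[OF assms]] by blast
  then have "packing_coloring s G k \<phi>"
    using le unfolding packing_coloring_def by fastforce
  then show "\<exists>\<phi>. packing_coloring s G k \<phi>" by blast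
qed (auto simp: packing_chromatic_def intro: Least_le)

text \<open>Forward, \<open>k\<close> is the chromatic number of the path, itself a proper subgraph.
  Backward, every proper subgraph inherits a \<open>k\<close>-coloring from the path.\<close>

lemma packing_critical_cycle_graph_iff:
  assumes n: "n \<ge> 3"
  shows "packing_critical s (cycle_graph n) \<longleftrightarrow>
    (\<exists>k. (\<exists>f. path_col s n k f) \<and> (\<nexists>f. cycle_col s n k f))"
proof
  let ?k = "packing_chromatic s (path_graph n)"
  assume "packing_critical s (cycle_graph n)"
  then have "\<not> packing_chromatic s (cycle_graph n) \<le> ?k"
    using proper_subgraph_path_graph[OF n] unfolding packing_critical_def not_le by blast
  then have "\<nexists>f. cycle_col s n ?k f"
    using packing_coloring_if_cycle_col[OF n]
    by (subst (asm) packing_chromatic_le_iff) (auto simp: cycle_graph_def)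
  moreover have "\<exists>\<phi>. packing_coloring s (path_graph n) ?k \<phi>"
    by (subst packing_chromatic_le_iff[symmetric]) (simp_all add: path_graph_def)
  ultimately show "\<exists>k. (\<exists>f. path_col s n k f) \<and> (\<nexists>f. cycle_col s n k f)"
    using path_col_if_packing_coloring by blast
next
  assume "\<exists>k. (\<exists>f. path_col s n k f) \<and> (\<nexists>f. cycle_col s n k f)"
  then obtain k f where k: "path_col s n k f" "\<nexists>f. cycle_col s n k f" by blast
  have "\<not> packing_chromatic s (cycle_graph n) \<le> k"
    using k(2) cycle_col_if_packing_coloring[OF n]
    by (subst packing_chromatic_le_iff) (auto simp: cycle_graph_def)
  moreover have "packing_chromatic s H \<le> k" if H: "proper_subgraph H (cycle_graph n)" for H
    using proper_subgraph_coloring[OF n H k(1)] H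
    by (subst packing_chromatic_le_iff) (auto simp: proper_subgraph_def simple_graph_def)
  ultimately show "packing_critical s (cycle_graph n)"
    unfolding packing_critical_def by fastforce
qed

section \<open>Obstructions\<close>

text \<open>Equal colors are never adjacent, so 1 and 2 would alternate, and 2 would recur at
  distance 2.\<close>

lemma spaced_12:
  assumes s: "s 1 = 1" "s 2 = 2" and sp: "spaced s f a (a + 4)"
  shows "\<exists>i\<in>{a..<a + 4}. f i \<noteq> 1 \<and> f i \<noteq> 2"
proof (rule ccontr)
  assume "\<not> ?thesis"
  then have c: "f i = 1 \<or> f i = 2" if "a \<le> i" "i < a + 4" for i using that by auto
  have no: "f (a + i) = f (a + j) \<Longrightarrow> s (f (a + i)) < j - i" if "i < j" "j < 4" for i j
    using spacedD[OF sp, of "a + i" "a + j"] that by simp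
  show False
    using c[of a] c[of "a + 1"] c[of "a + 2"] c[of "a + 3"] no[of 0 1] no[of 1 2] no[of 2 3]
      no[of 0 2] no[of 1 3] s by auto
qed

text \<open>A vertex of color 3 among the first four is followed within distance 4 by another one.\<close>

lemma spaced_123:
  assumes s: "s 1 = 1" "s 2 = 2" "s 3 \<ge> 4"
    and sp: "\<And>b. a \<le> b \<Longrightarrow> b \<le> a + 3 \<Longrightarrow> spaced s f b (b + 5)"
  shows "\<exists>i\<in>{a..<a + 8}. f i \<noteq> 1 \<and> f i \<noteq> 2 \<and> f i \<noteq> 3"
proof (rule ccontr)
  assume "\<not> ?thesis"
  then have c: "f i = 1 \<or> f i = 2 \<or> f i = 3" if "a \<le> i" "i < a + 8" for i using that by auto
  have "spaced s f a (a + 4)" using sp[of a] by (rule spaced_subset) auto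
  from spaced_12[OF s(1,2) this]
  obtain i where i: "i \<in> {a..<a + 4}" "f i \<noteq> 1" "f i \<noteq> 2" by (elim bexE conjE)
  then have "f i = 3" using c[of i] by auto
  have "spaced s f i (i + 5)" using i by (intro sp) auto
  then have "spaced s f (i + 1) (i + 1 + 4)" by (rule spaced_subset) simp_all
  from spaced_12[OF s(1,2) this]
  obtain j where j: "j \<in> {i + 1..<i + 1 + 4}" "f j \<noteq> 1" "f j \<noteq> 2" by (elim bexE conjE)
  then have "f j = 3" using c[of j] i by auto
  then have "s (f i) < j - i"
    using \<open>f i = 3\<close> j by (intro spacedD[OF \<open>spaced s f i (i + 5)\<close>]) auto
  then show False using \<open>f i = 3\<close> j s(3) by auto
qed

section \<open>Counting color 4 in cyclic windows\<close>

text \<open>A shift by one drops position \<open>d\<close> and gains \<open>d + n\<close>, which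
  have the same color.\<close>

lemma cycle_count_shift:
  assumes "cycle_col s n k f"
  shows "(\<Sum>i<n. of_bool (f (i + d) = c)) = (\<Sum>i<n. of_bool (f i = c) :: nat)"
proof (induction d)
  case (Suc d)
  have "(\<Sum>i<n. of_bool (f (i + Suc d) = c) :: nat) + of_bool (f d = c) =
      (\<Sum>i<Suc n. of_bool (f (i + d) = c))"
    by (subst sum.lessThan_Suc_shift) simp
  also have "\<dots> = (\<Sum>i<n. of_bool (f (i + d) = c)) + of_bool (f d = c)"
    using cycle_colD(2)[OF assms, of d] by (simp add: add.commute)
  finally show ?case using Suc by simp
qed simp

text \<open>Double counting: after exchanging the sums, each of the \<open>m\<close> offsets
  contributes the full count of color \<open>c\<close>.\<close>

lemma cycle_count_windows:
  assumes "cycle_col s n k f"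
  shows "(\<Sum>i<n. \<Sum>d<m. of_bool (f (i + d) = c)) = m * (\<Sum>i<n. of_bool (f i = c) :: nat)"
proof -
  have "(\<Sum>i<n. \<Sum>d<m. of_bool (f (i + d) = c)) = (\<Sum>d<m. \<Sum>i<n. of_bool (f (i + d) = c) :: nat)"
    by (rule sum.swap)
  also have "\<dots> = m * (\<Sum>i<n. of_bool (f i = c))"
    unfolding cycle_count_shift[OF assms] by simp
  finally show ?thesis .
qed

text \<open>Sum over all \<open>n\<close> cyclic windows: at least one 4 in each window of length 8
  gives \<open>n \<le> 8 * q\<close>, at most one in each of length \<open>s 4 + 1\<close> gives the
  other bound.\<close>

lemma cycle_4_col_bounds:
  assumes s: "s 1 = 1" "s 2 = 2" "s 3 \<ge> 4" and n: "n \<ge> 8" "n > s 4" and f: "cycle_col s n 4 f"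
  shows "\<exists>q. (s 4 + 1) * q \<le> n \<and> n \<le> 8 * q"
proof -
  define q where "q = (\<Sum>i<n. of_bool (f i = 4) :: nat)"
  have "(\<Sum>d<8. of_bool (f (i + d) = 4) :: nat) \<ge> 1" for i
  proof -
    have "\<exists>j\<in>{i..<i + 8}. f j \<noteq> 1 \<and> f j \<noteq> 2 \<and> f j \<noteq> 3"
      using s n by (intro spaced_123[of s] cycle_colD(3)[OF f]) auto
    then obtain j where j: "i \<le> j" "j < i + 8" "f j \<noteq> 1" "f j \<noteq> 2" "f j \<noteq> 3" by auto
    then have "f j = 4" using cycle_colD(1)[OF f, of j] by auto
    with j have "of_bool (f (i + (j - i)) = 4) = (1 :: nat)" "j - i \<in> {..<8}" by auto
    then show ?thesis
      by (metis (no_types, lifting) finite_lessThan member_le_sum zero_le)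
  qed
  then have "(\<Sum>i<n. 1) \<le> (\<Sum>i<n. \<Sum>d<8. of_bool (f (i + d) = 4) :: nat)"
    by (intro sum_mono)
  then have "n \<le> 8 * q" by (simp only: cycle_count_windows[OF f] q_def) simp
  have "(\<Sum>d<s 4 + 1. of_bool (f (i + d) = 4) :: nat) \<le> 1" for i
  proof -
    have "d = d'" if "d < s 4 + 1" "d' < s 4 + 1" "f (i + d) = 4" "f (i + d') = 4" for d d'
      using that n spacedD[OF cycle_colD(3)[OF f, of "i + n" i], of "i + d" "i + d'"]
        spacedD[OF cycle_colD(3)[OF f, of "i + n" i], of "i + d'" "i + d"]
      by (cases d d' rule: linorder_cases) auto
    then have "card {d. d < s 4 + 1 \<and> f (i + d) = 4} \<le> 1"
      by (auto simp: card_le_Suc0_iff_eq)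
    then show ?thesis by (simp add: Int_def del: sum.lessThan_Suc)
  qed
  then have "(\<Sum>i<n. \<Sum>d<s 4 + 1. of_bool (f (i + d) = 4) :: nat) \<le> (\<Sum>i<n. 1)"
    by (intro sum_mono)
  then have "(s 4 + 1) * q \<le> n" by (simp only: cycle_count_windows[OF f] q_def) simp
  with \<open>n \<le> 8 * q\<close> show ?thesis by blast
qed

lemma path_col_ge_3:
  assumes "s 1 = 1" "s 2 = 2" "n \<ge> 4" "path_col s n k f"
  shows "k \<ge> 3"
proof -
  have "spaced s f 0 (0 + 4)" using assms spaced_subset[of s f 0 n 0 4] by (simp add: path_col_def)
  then obtain i where "i < 4" "f i \<noteq> 1" "f i \<noteq> 2" using spaced_12[of s f 0] assms by auto
  moreover have "f i \<in> {1..k}" using assms \<open>i < 4\<close> by (auto simp: path_col_def image_subset_iff)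
  ultimately show ?thesis by auto
qed

lemma path_col_ge_4:
  assumes "s 1 = 1" "s 2 = 2" "s 3 \<ge> 4" "n \<ge> 8" "path_col s n k f"
  shows "k \<ge> 4"
proof -
  have "spaced s f b (b + 5)" if "b \<le> 3" for b
    using assms that spaced_subset[of s f 0 n b "b + 5"] by (simp add: path_col_def)
  then obtain i where "i < 8" "f i \<noteq> 1" "f i \<noteq> 2" "f i \<noteq> 3"
    using spaced_123[of s 0 f] assms by auto
  moreover have "f i \<in> {1..k}" using assms \<open>i < 8\<close> by (auto simp: path_col_def image_subset_iff)
  ultimately show ?thesis by auto
qed

text \<open>For \<open>n < 8\<close> the eight positions examined wrap around. This is harmless,
  since \<open>spaced_123\<close> asks for spacing only in windows of length 5, and these fit into
  one period.\<close>

lemma no_cycle_3_col: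
  assumes s: "s 1 = 1" "s 2 = 2" "s 3 \<ge> 4" and n: "n \<ge> 5"
  shows "\<not> cycle_col s n 3 f"
proof
  assume f: "cycle_col s n 3 f"
  then have "\<exists>i\<in>{0..<0 + 8}. f i \<noteq> 1 \<and> f i \<noteq> 2 \<and> f i \<noteq> 3"
    using s n by (intro spaced_123[of s] cycle_colD(3)[OF f]) auto
  then obtain i where "f i \<noteq> 1" "f i \<noteq> 2" "f i \<noteq> 3" by blast
  then show False using cycle_colD(1)[OF f, of i] by auto
qed

text \<open>Adjacent vertices differ in color, and an odd cycle is not 2-colorable.\<close>

lemma no_triangle_2_col:
  assumes s: "s 1 = 1" "s 2 = 2"
  shows "\<not> cycle_col s 3 2 f"
proof
  assume f: "cycle_col s 3 2 f"
  have "f i \<noteq> f (i + 1)" for i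
    using spacedD[OF cycle_colD(3)[OF f, of "i + 3" i], of i "i + 1"] cycle_colD(1)[OF f, of i] s
    by (auto simp: le_Suc_eq numeral_2_eq_2)
  from this[of 0] this[of 1] this[of 2] show False
    using cycle_colD(2)[OF f, of 0] cycle_colD(1)[OF f, of 0] cycle_colD(1)[OF f, of 1]
      cycle_colD(1)[OF f, of 2]
    by (auto simp: numeral_2_eq_2 numeral_3_eq_3)
qed

section \<open>Colorings by blocks\<close>

text \<open>A form of \<open>spaced\<close> that simplification decides on concrete words. It looks
  only forward, which suits building words by prepending blocks.\<close>

primrec spaced_list :: "(nat \<Rightarrow> nat) \<Rightarrow> nat list \<Rightarrow> bool" where
  "spaced_list s [] \<longleftrightarrow> True"
| "spaced_list s (x # xs) \<longleftrightarrow> x \<notin> set (take (s x) xs) \<and> spaced_list s xs"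

lemma spaced_listD:
  "spaced_list s xs \<Longrightarrow> i < j \<Longrightarrow> j < length xs \<Longrightarrow> xs ! i = xs ! j \<Longrightarrow> s (xs ! i) < j - i"
proof (induction xs arbitrary: i j)
  case (Cons x xs)
  then obtain j' where j: "j = Suc j'" by (cases j) auto
  show ?case
  proof (cases i)
    case 0
    have "x = take (s x) xs ! j'" if "j' < s x" using Cons.prems j 0 that by simp
    then have "\<not> j' < s x"
      using Cons.prems j 0 nth_mem[of j' "take (s x) xs"] by force
    then show ?thesis using j 0 by simp
  next
    case (Suc i')
    then show ?thesis using Cons j by simp
  qed
qed simp

lemma spaced_list_mono:
  assumes "spaced_list t xs" "\<And>x. x \<in> set xs \<Longrightarrow> s x \<le> t x"
  shows "spaced_list s xs"
  using assms
proof (induction xs)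
  case (Cons x xs)
  then show ?case using set_take_subset_set_take[of "s x" "t x" xs] by auto
qed simp

lemma path_col_if_spaced_list:
  assumes "spaced_list s w" "set w \<subseteq> {1..k}" "n \<le> length w"
  shows "path_col s n k ((!) w)"
  unfolding path_col_def spaced_def
proof (intro conjI allI impI)
  show "(!) w ` {0..<n} \<subseteq> {1..k}"
    using assms(2,3) by (force simp: subset_iff)
  show "s (w ! i) < j - i" if "0 \<le> i \<and> i < j \<and> j < n \<and> w ! i = w ! j" for i j
    using that assms(3) by (intro spaced_listD[OF assms(1)]) auto
qed

text \<open>Two positions less than \<open>n\<close> apart can be shifted by a multiple of
  \<open>n\<close> so that the first lies in the first copy of \<open>w\<close>; the second then
  still lies in \<open>w @ w\<close>.\<close>

lemma cycle_col_if_spaced_list: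
  assumes w: "spaced_list s (w @ w)" "set w \<subseteq> {1..k}" "length w = n" and n: "n > 0"
  shows "cycle_col s n k (\<lambda>i. w ! (i mod n))"
proof -
  have "s (w ! (i mod n)) < j - i"
    if "a \<le> i" "i < j" "j < a + n" "w ! (i mod n) = w ! (j mod n)" for a i j
  proof -
    let ?i = "i mod n" and ?j = "i mod n + (j - i)"
    have "?j < 2 * n" using that n mod_less_divisor[of n i] by linarith
    have "?j mod n = (i + (j - i)) mod n" by (rule mod_add_left_eq)
    then have "?j mod n = j mod n" using that by simp
    moreover have ww: "(w @ w) ! l = w ! (l mod n)" if "l < 2 * n" for l
      using that w(3) by (auto simp: nth_append mod_if)
    ultimately have "(w @ w) ! ?i = (w @ w) ! ?j"
      using that n \<open>?j < 2 * n\<close> by simp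
    then have "s ((w @ w) ! ?i) < ?j - ?i"
      using w \<open>?j < 2 * n\<close> that by (intro spaced_listD) auto
    then show ?thesis using ww[of ?i] \<open>?j < 2 * n\<close> by simp
  qed
  moreover have "w ! (i mod n) \<in> {1..k}" for i
    using w n by (metis mod_less_divisor nth_mem subsetD)
  ultimately show ?thesis by (auto simp: cycle_col_def spaced_def)
qed

text \<open>Bounds on colors 1 to 4 every sequence considered with \<open>s 4 = m\<close>, whatever
  \<open>s 3 \<le> m\<close> is, so blocks are checked once for each \<open>m\<close>.\<close>

definition gap_seq :: "nat \<Rightarrow> nat \<Rightarrow> nat" where
  "gap_seq m x = (if x \<le> 2 then x else m)"

text \<open>Words that may follow any block of length greater than \<open>m\<close>.\<close>

definition block_tail :: "nat \<Rightarrow> nat list \<Rightarrow> bool" where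
  "block_tail m w \<longleftrightarrow> spaced_list (gap_seq m) w \<and> 2 \<notin> set (take 1 w) \<and>
     3 \<notin> set (take (m div 2) w) \<and> 4 \<notin> set (take m w)"

text \<open>The only 4 comes last, so consecutive 4s in a concatenation are one block length apart.
  The final branch is meant for length 8.\<close>

definition block :: "nat \<Rightarrow> nat list" where
  "block l = (if l = 5 then [1, 2, 3, 1, 4] else if l = 6 then [1, 2, 3, 1, 2, 4]
     else if l = 7 then [1, 2, 1, 3, 2, 1, 4] else [1, 2, 1, 3, 1, 2, 1, 4])"

text \<open>The final 4 bars 4 from the next \<open>m\<close> letters. In a block longer than
  \<open>m\<close>, at least \<open>m - m div 2\<close> letters follow the 3, so it bars 3 from at
  most \<open>m div 2\<close> letters of the tail; the last 2 is followed by at least one letter, so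
  it bars 2 from at most one.\<close>

lemma block_tail_append:
  assumes "m \<in> {4, 5, 6}" "l \<in> {m + 1..8}" "block_tail m w"
  shows "block_tail m (block l @ w)"
proof -
  \<comment> \<open>Unfolding a block leaves prefixes of \<open>w\<close> of various lengths, all
    within these bounds.\<close>
  have 3: "3 \<notin> set (take i w)" if "i \<le> m div 2" for i
    using assms(3) that set_take_subset_set_take[of i "m div 2" w] by (auto simp: block_tail_def)
  have 4: "4 \<notin> set (take i w)" if "i \<le> m" for i
    using assms(3) that set_take_subset_set_take[of i m w] by (auto simp: block_tail_def)
  have "m = 4 \<and> l \<in> {5, 6, 7, 8} \<or> m = 5 \<and> l \<in> {6, 7, 8} \<or> m = 6 \<and> l \<in> {7, 8}"
    using assms(1,2) by auto
  then show ?thesis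
    using assms(3) 3 4
    by (elim disjE conjE insertE emptyE) (auto simp: block_tail_def block_def gap_seq_def)
qed

text \<open>The word is required to preserve tails rather than just to be one, so that it can be
  prepended to itself to close the cycle.\<close>

lemma ex_block_word:
  assumes "m \<in> {4, 5, 6}" "(m + 1) * q \<le> n" "n \<le> 8 * q"
  shows "\<exists>w. length w = n \<and> set w \<subseteq> {1..4} \<and> (\<forall>v. block_tail m v \<longrightarrow> block_tail m (w @ v))"
  using assms(2,3)
proof (induction q arbitrary: n)
  case (Suc q)
  \<comment> \<open>The shortest admissible block that leaves at most \<open>8 * q\<close> letters
    for the other \<open>q\<close> blocks; the subtraction is truncated.\<close>
  define l where "l = max (m + 1) (n - 8 * q)"
  have l: "l \<in> {m + 1..8}" "(m + 1) * q \<le> n - l" "n - l \<le> 8 * q" "l \<le> n"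
    using Suc.prems assms(1) by (auto simp: l_def max_def)
  then obtain w where w: "length w = n - l" "set w \<subseteq> {1..4}"
    "\<And>v. block_tail m v \<Longrightarrow> block_tail m (w @ v)"
    using Suc.IH by blast
  have "length (block l) = l" using l assms(1) by (auto simp: block_def)
  moreover have "set (block l) \<subseteq> {1..4}" by (simp add: block_def)
  ultimately show ?case
    using w l block_tail_append[OF assms(1) l(1)] by (intro exI[of _ "block l @ w"]) auto
qed simp

lemma ex_4_cols:
  assumes m: "m \<in> {4, 5, 6}" and s: "s 1 = 1" "s 2 = 2" "s 3 \<le> m" "s 4 = m"
  shows "\<exists>f. path_col s n 4 f"
    and "(m + 1) * q \<le> n \<Longrightarrow> n \<le> 8 * q \<Longrightarrow> n > 0 \<Longrightarrow> \<exists>f. cycle_col s n 4 f"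
proof -
  have le: "s x \<le> gap_seq m x" if "x \<in> {1..4}" for x
  proof -
    have "x = 1 \<or> x = 2 \<or> x = 3 \<or> x = 4" using that by auto
    then show ?thesis using s by (auto simp: gap_seq_def)
  qed
  have Nil: "block_tail m []" by (simp add: block_tail_def)
  have spaced: "spaced_list s w" if "block_tail m w" "set w \<subseteq> {1..4}" for w
  proof (rule spaced_list_mono)
    show "spaced_list (gap_seq m) w" using that(1) by (simp add: block_tail_def)
    show "s x \<le> gap_seq m x" if "x \<in> set w" for x using le that \<open>set w \<subseteq> {1..4}\<close> by blast
  qed
  \<comment> \<open>A path needs only a prefix of a long enough word; \<open>n\<close> blocks of
    length 8 suffice.\<close>
  have "(m + 1) * n \<le> 8 * n" using m by auto
  then obtain w where w: "length w = 8 * n" "set w \<subseteq> {1..4}" "block_tail m w"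
    using ex_block_word[OF m _ order_refl, of n] Nil by (metis append_Nil2)
  then show "\<exists>f. path_col s n 4 f"
    using path_col_if_spaced_list[of s w 4 n] spaced by auto
  show "\<exists>f. cycle_col s n 4 f" if q: "(m + 1) * q \<le> n" "n \<le> 8 * q" "n > 0"
  proof -
    \<comment> \<open>Apply the preservation of tails first to the empty word, then to
      \<open>w\<close> itself.\<close>
    obtain w where w: "length w = n" "set w \<subseteq> {1..4}" "block_tail m (w @ w)"
      using ex_block_word[OF m q(1,2)] Nil by (metis append_Nil2)
    then show ?thesis
      using cycle_col_if_spaced_list[of s w 4 n] spaced[of "w @ w"] q by auto
  qed
qed

section \<open>Classification by the number of blocks\<close>

lemma packing_critical_cycle_graph:
  assumes m: "m \<in> {4, 5, 6}" and s: "s 1 = 1" "s 2 = 2" "4 \<le> s 3" "s 3 \<le> m" "s 4 = m"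
    and n: "n \<ge> 3"
  shows "packing_critical s (cycle_graph n) \<longleftrightarrow>
    n \<in> {3, 5, 6, 7} \<or> n \<ge> 9 \<and> (\<nexists>q. (m + 1) * q \<le> n \<and> n \<le> 8 * q)"
proof -
  have small: "spaced_list s [1, 2, 1, 3, 1, 2, 1]" "spaced_list s [1, 2, 1]"
    using s by (auto dest!: in_set_takeD)
  consider "n = 3" | "n = 4" | "n \<in> {5, 6, 7}" | "n \<ge> 8" using n by fastforce
  then show ?thesis
  proof cases
    case 1
    have "path_col s n 2 ((!) [1, 2, 1])"
      using small 1 by (intro path_col_if_spaced_list) auto
    moreover have "\<nexists>f. cycle_col s n 2 f" using no_triangle_2_col[OF s(1,2)] 1 by simp
    ultimately show ?thesis
      using 1 unfolding packing_critical_cycle_graph_iff[OF n] by blast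
  next
    case 2
    \<comment> \<open>Doubling the word would not work: 3 recurs at distance 4, which does not
      exceed \<open>s 3\<close>. On the cycle this is the same vertex, so only differences 1 to 3
      are checked.\<close>
    have "cycle_col s n k (\<lambda>i. [1, 2, 1, 3] ! (i mod n))" if "k \<ge> 3" for k
    proof -
      have "s ([1, 2, 1, 3] ! (i mod 4)) < d"
        if eq: "[1, 2, 1, 3 :: nat] ! (i mod 4) = [1, 2, 1, 3] ! ((i mod 4 + d) mod 4)"
          and "0 < d" "d < 4" for i d
      proof -
        have "i mod 4 \<in> {0, 1, 2, 3}" "d \<in> {1, 2, 3}" using that by auto
        then show ?thesis using eq s by auto
      qed
      note residues = this
      have "s ([1, 2, 1, 3] ! (i mod 4)) < j - i"
        if "a \<le> i" "i < j" "j < a + 4" "[1, 2, 1, 3 :: nat] ! (i mod 4) = [1, 2, 1, 3] ! (j mod 4)"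
        for a i j
      proof -
        have "(i mod 4 + (j - i)) mod 4 = (i + (j - i)) mod 4" by (rule mod_add_left_eq)
        then have "(i mod 4 + (j - i)) mod 4 = j mod 4" using that by simp
        then show ?thesis using that residues[of i "j - i"] by simp
      qed
      moreover have "[1, 2, 1, 3] ! (i mod 4) \<in> {1..k}" for i
      proof -
        have "i mod 4 \<in> {0, 1, 2, 3}" by auto
        then show ?thesis using that by auto
      qed
      ultimately show ?thesis using 2 by (auto simp: cycle_col_def spaced_def)
    qed
    then have "\<exists>f. cycle_col s n k f" if "path_col s n k f" for k f
      using path_col_ge_3[OF s(1,2) _ that] 2 by blast
    then show ?thesis
      using 2 unfolding packing_critical_cycle_graph_iff[OF n] by auto
  next
    case 3
    have "path_col s n 3 ((!) [1, 2, 1, 3, 1, 2, 1])"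
      using small 3 by (intro path_col_if_spaced_list) auto
    moreover have "\<nexists>f. cycle_col s n 3 f" using no_cycle_3_col[OF s(1,2,3)] 3 by auto
    ultimately show ?thesis
      using 3 unfolding packing_critical_cycle_graph_iff[OF n] by blast
  next
    case 4
    have path: "\<exists>f. path_col s n 4 f" using ex_4_cols(1)[of m s n] m s by blast
    have "packing_critical s (cycle_graph n) \<longleftrightarrow> (\<nexists>f. cycle_col s n 4 f)"
    proof -
      \<comment> \<open>Only \<open>k = 4\<close> matters: a path coloring forces
        \<open>k \<ge> 4\<close>, and a 4-coloring of the cycle is also a
        \<open>k\<close>-coloring.\<close>
      have "cycle_col s n k f" if "cycle_col s n 4 f" "path_col s n k g" for k f g
      proof -
        have "{1..4} \<subseteq> {1..k}" using path_col_ge_4[OF s(1,2,3) 4 that(2)] by simp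
        then show ?thesis using that(1) unfolding cycle_col_def by blast
      qed
      then show ?thesis using path unfolding packing_critical_cycle_graph_iff[OF n] by blast
    qed
    also have "\<dots> \<longleftrightarrow> (\<nexists>q. (m + 1) * q \<le> n \<and> n \<le> 8 * q)"
    proof -
      have "n > s 4" using m s(5) 4 by auto
      then have "\<exists>q. (m + 1) * q \<le> n \<and> n \<le> 8 * q" if "cycle_col s n 4 f" for f
        using cycle_4_col_bounds[OF s(1,2,3) 4 _ that] s(5) by simp
      moreover have "n > 0" using 4 by simp
      ultimately show ?thesis using ex_4_cols(2)[OF m s(1,2,4,5)] by blast
    qed
    also have "\<dots> \<longleftrightarrow> n \<ge> 9 \<and> (\<nexists>q. (m + 1) * q \<le> n \<and> n \<le> 8 * q)"
    proof -
      \<comment> \<open>For \<open>n = 8\<close> a single block fits.\<close>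
      have "(m + 1) * 1 \<le> 8" using m by auto
      then show ?thesis using 4 by (cases "n = 8") (auto intro: exI[of _ 1])
    qed
    finally show ?thesis using 4 by auto
  qed
qed

text \<open>Only the least \<open>q\<close> with \<open>n \<le> 8 * q\<close> need be tested, as it
  makes the lower bound on \<open>n\<close> weakest.\<close>

lemma no_block_count_iff:
  fixes n :: nat
  assumes "n \<ge> 9"
  shows "(\<nexists>q. 5 * q \<le> n \<and> n \<le> 8 * q) \<longleftrightarrow> n = 9"
    and "(\<nexists>q. 6 * q \<le> n \<and> n \<le> 8 * q) \<longleftrightarrow> n \<in> {9, 10, 11, 17}"
    and "(\<nexists>q. 7 * q \<le> n \<and> n \<le> 8 * q) \<longleftrightarrow>
      n \<in> {9, 10, 11, 12, 13, 17, 18, 19, 20, 25, 26, 27, 33, 34, 41}"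
proof -
  \<comment> \<open>This \<open>q\<close> is \<open>n / 8\<close> rounded up.\<close>
  obtain q where q: "n \<le> 8 * q" "8 * q < n + 8"
    by (rule that[of "(n + 7) div 8"]) auto
  \<comment> \<open>From \<open>8 * q - 7 \<le> n \<le> 7 * q - 1\<close> follows
    \<open>q \<le> 6\<close>, and \<open>n \<ge> 9\<close> gives \<open>q \<ge> 2\<close>. Factors 5
    and 6 imply the same premise.\<close>
  have small: "q = 2 \<or> q = 3 \<or> q = 4 \<or> q = 5 \<or> q = 6" if "n < 7 * q"
    using that q assms by linarith
  show "(\<nexists>q. 5 * q \<le> n \<and> n \<le> 8 * q) \<longleftrightarrow> n = 9"
  proof
    assume "\<nexists>q. 5 * q \<le> n \<and> n \<le> 8 * q"
    then have "n < 5 * q" using q by (metis not_le)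
    then show "n = 9" using q assms small by auto
  next
    assume n: "n = 9"
    show "\<nexists>q. 5 * q \<le> n \<and> n \<le> 8 * q"
    proof
      assume "\<exists>q. 5 * q \<le> n \<and> n \<le> 8 * q"
      then obtain p where p: "5 * p \<le> n" "n \<le> 8 * p" by blast
      have "n \<le> 9" using n by auto
      then have "p = 0 \<or> p = 1 \<or> p = 2 \<or> p = 3 \<or> p = 4 \<or> p = 5" using p by linarith
      then show False using n p by (elim disjE) auto
    qed
  qed
  show "(\<nexists>q. 6 * q \<le> n \<and> n \<le> 8 * q) \<longleftrightarrow> n \<in> {9, 10, 11, 17}"
  proof
    assume "\<nexists>q. 6 * q \<le> n \<and> n \<le> 8 * q"
    then have "n < 6 * q" using q by (metis not_le)
    then show "n \<in> {9, 10, 11, 17}" using q assms small by auto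
  next
    assume n: "n \<in> {9, 10, 11, 17}"
    show "\<nexists>q. 6 * q \<le> n \<and> n \<le> 8 * q"
    proof
      assume "\<exists>q. 6 * q \<le> n \<and> n \<le> 8 * q"
      then obtain p where p: "6 * p \<le> n" "n \<le> 8 * p" by blast
      have "n \<le> 17" using n by auto
      then have "p = 0 \<or> p = 1 \<or> p = 2 \<or> p = 3 \<or> p = 4 \<or> p = 5" using p by linarith
      then show False using n p by (elim disjE) auto
    qed
  qed
  show "(\<nexists>q. 7 * q \<le> n \<and> n \<le> 8 * q) \<longleftrightarrow>
      n \<in> {9, 10, 11, 12, 13, 17, 18, 19, 20, 25, 26, 27, 33, 34, 41}"
  proof
    assume "\<nexists>q. 7 * q \<le> n \<and> n \<le> 8 * q"
    then have "n < 7 * q" using q by (metis not_le)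
    then show "n \<in> {9, 10, 11, 12, 13, 17, 18, 19, 20, 25, 26, 27, 33, 34, 41}"
      using q assms small by auto
  next
    assume n: "n \<in> {9, 10, 11, 12, 13, 17, 18, 19, 20, 25, 26, 27, 33, 34, 41}"
    show "\<nexists>q. 7 * q \<le> n \<and> n \<le> 8 * q"
    proof
      assume "\<exists>q. 7 * q \<le> n \<and> n \<le> 8 * q"
      then obtain p where p: "7 * p \<le> n" "n \<le> 8 * p" by blast
      have "n \<le> 41" using n by auto
      then have "p = 0 \<or> p = 1 \<or> p = 2 \<or> p = 3 \<or> p = 4 \<or> p = 5" using p by linarith
      then show False using n p by (elim disjE) auto
    qed
  qed
qed

theorem theorem4p1:
  fixes n :: nat and s :: "nat \<Rightarrow> nat"
  assumes "n \<ge> 3"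
  shows "(s \<in> packing_seqs [1, 2, 4, 4] \<longrightarrow>
            (packing_critical s (cycle_graph n) \<longleftrightarrow> n \<in> {3, 5, 6, 7, 9})) \<and>
         (s \<in> packing_seqs_bar 3 [1, 2, 4, 5] \<longrightarrow>
            (packing_critical s (cycle_graph n) \<longleftrightarrow> n \<in> {3, 5, 6, 7, 9, 10, 11, 17})) \<and>
         (s \<in> packing_seqs_bar 3 [1, 2, 4, 6] \<longrightarrow>
            (packing_critical s (cycle_graph n) \<longleftrightarrow>
               n \<in> {3, 5, 6, 7, 9, 10, 11, 12, 13, 17, 18, 19, 20, 25, 26, 27, 33, 34, 41}))"
proof (intro conjI impI)
  assume s: "s \<in> packing_seqs [1, 2, 4, 4]"
  have "s j = [1, 2, 4, 4] ! (j - 1)" if "j \<in> {1..4}" for j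
    using s that by (simp add: packing_seqs_def)
  from this[of 1] this[of 2] this[of 3] this[of 4]
  have "s 1 = 1" "s 2 = 2" "s 3 = 4" "s 4 = 4" by simp_all
  then show "packing_critical s (cycle_graph n) \<longleftrightarrow> n \<in> {3, 5, 6, 7, 9}"
    using packing_critical_cycle_graph[of 4 s n] no_block_count_iff(1)[of n] assms by auto
next
  assume s: "s \<in> packing_seqs_bar 3 [1, 2, 4, 5]"
  \<comment> \<open>Index 3 carries the bar; its bounds are the third and fourth list
    entries.\<close>
  have "s j = [1, 2, 4, 5] ! (j - 1)" if "j \<in> {1..4} - {3}" for j
    using s that by (simp add: packing_seqs_bar_def)
  from this[of 1] this[of 2] this[of 4]
  have "s 1 = 1" "s 2 = 2" "4 \<le> s 3" "s 3 \<le> 5" "s 4 = 5"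
    using s by (simp_all add: packing_seqs_bar_def)
  then show "packing_critical s (cycle_graph n) \<longleftrightarrow> n \<in> {3, 5, 6, 7, 9, 10, 11, 17}"
    using packing_critical_cycle_graph[of 5 s n] no_block_count_iff(2)[of n] assms by auto
next
  assume s: "s \<in> packing_seqs_bar 3 [1, 2, 4, 6]"
  have "s j = [1, 2, 4, 6] ! (j - 1)" if "j \<in> {1..4} - {3}" for j
    using s that by (simp add: packing_seqs_bar_def)
  from this[of 1] this[of 2] this[of 4]
  have "s 1 = 1" "s 2 = 2" "4 \<le> s 3" "s 3 \<le> 6" "s 4 = 6"
    using s by (simp_all add: packing_seqs_bar_def)
  then show "packing_critical s (cycle_graph n) \<longleftrightarrow>
      n \<in> {3, 5, 6, 7, 9, 10, 11, 12, 13, 17, 18, 19, 20, 25, 26, 27, 33, 34, 41}"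
    using packing_critical_cycle_graph[of 6 s n] no_block_count_iff(3)[of n] assms by auto
qed

end
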